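(* Let $N\ge 0$ be an integer and let $\mathbf{B}(x)=[B_0(x),B_1(x),\dots,B_N(x)]^T$ be the vector of the Bernoulli polynomials of degrees $0,\dots,N$. Let $\mathcal{D}$ be the $(N+1)\times(N+1)$ operational matrix of derivatives of $\mathbf{B}$, that is, the constant real matrix characterized by $$\frac{d}{dx}\mathbf{B}(x)=\mathcal{D}\,\mathbf{B}(x)\qquad\text{for all } x\in[0,1].$$ Then the elements of $\mathcal{D}=(\mathcal{D}_{i,j})_{i,j=0}^{N}$, with rows and columns indexed from $0$ to $N$, are $$\mathcal{D}_{i,j}=\begin{cases} i, & i=j+1,\\ 0, & \text{otherwise.}\end{cases}$$
   Context: The Bernoulli polynomials $B_n(x)$, considered on $[0,1]$, are $B_n(x)=\sum_{k=0}^{n}\binom{n}{k}B_k\,x^{n-k}$, where $B_k:=B_k(0)$ are the Bernoulli numbers, with the convention $B_1=-\tfrac12$; equivalently, $\dfrac{te^{xt}}{e^t-1}=\sum_{n=0}^{\infty}B_n(x)\dfrac{t^n}{n!}$. For instance $B_0(x)=1$, $B_1(x)=x-\tfrac12$, $B_2(x)=x^2-x+\tfrac16$. The derivative of the vector $\mathbf{B}(x)$ is taken entrywise. A matrix $\mathcal{D}$ is called the operational matrix of derivatives of $\mathbf{B}$ if and only if $\frac{d}{dx}\mathbf{B}(x)=\mathcal{D}\,\mathbf{B}(x)$. *)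

theory Defs
  imports
    Complex_Main
    "HOL-Computational_Algebra.Formal_Power_Series"
    "Jordan_Normal_Form.Matrix"
begin

text \<open>
  The Bernoulli numbers are the exponential coefficients of \<open>t / (exp t - 1)\<close>, so \<open>B\<^sub>1 = -1/2\<close>.
  The quotient is division in the ring of formal power series. It is exact because both
  numerator and denominator have subdegree 1.
\<close>

definition bernoulli :: "nat \<Rightarrow> real" where
  "bernoulli k = fact k * fps_nth (fps_X div (fps_exp 1 - 1)) k"

definition bernpoly :: "nat \<Rightarrow> real \<Rightarrow> real" where
  "bernpoly n x = (\<Sum>k\<le>n. real (n choose k) * bernoulli k * x ^ (n - k))"

definition bernvec :: "nat \<Rightarrow> real \<Rightarrow> real vec" where
  "bernvec N x = vec (N + 1) (\<lambda>i. bernpoly i x)"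

text \<open>Derivatives are relative to \<open>S\<close>: at an endpoint of an interval they are one-sided.\<close>

definition has_entrywise_derivative ::
    "(real \<Rightarrow> real vec) \<Rightarrow> real vec \<Rightarrow> real \<Rightarrow> real set \<Rightarrow> bool" where
  "has_entrywise_derivative F v x S \<longleftrightarrow>
     (\<forall>t\<in>S. dim_vec (F t) = dim_vec v) \<and>
     (\<forall>i<dim_vec v. ((\<lambda>t. F t $ i) has_real_derivative v $ i) (at x within S))"

definition operational_matrix_of_derivatives ::
    "nat \<Rightarrow> (real \<Rightarrow> real vec) \<Rightarrow> real set \<Rightarrow> real mat \<Rightarrow> bool" where
  "operational_matrix_of_derivatives n F S D \<longleftrightarrow>
     D \<in> carrier_mat n n \<and>
     (\<forall>x\<in>S. F x \<in> carrier_vec n \<and> has_entrywise_derivative F (D *\<^sub>v F x) x S)"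

lemma fps_exp_minus_1_neq_0: "fps_exp (1::real) - 1 \<noteq> 0"
proof
  assume "fps_exp (1::real) - 1 = 0"
  then have "fps_nth (fps_exp (1::real) - 1) 1 = 0" by simp
  then show False by simp
qed

lemma subdegree_fps_exp_minus_1: "subdegree (fps_exp (1::real) - 1) = 1"
proof (rule subdegreeI)
  show "fps_nth (fps_exp (1::real) - 1) 1 \<noteq> 0" by simp
qed auto

lemma bernoulli_egf: "Abs_fps (\<lambda>k. bernoulli k / fact k) * (fps_exp 1 - 1) = fps_X"
proof -
  have "Abs_fps (\<lambda>k. bernoulli k / fact k) = fps_X div (fps_exp 1 - 1)"
    by (simp add: fps_eq_iff bernoulli_def)
  moreover have "(fps_exp (1::real) - 1) dvd fps_X"
    by (simp only: fps_dvd_iff[OF fps_exp_minus_1_neq_0 fps_X_neq_zero]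
        subdegree_fps_exp_minus_1 subdegree_fps_X order_refl)
  ultimately show ?thesis by simp
qed

lemma bernpoly_egf:
  "Abs_fps (\<lambda>n. bernpoly n x / fact n) * (fps_exp 1 - 1) = fps_X * fps_exp x"
proof -
  have "Abs_fps (\<lambda>n. bernpoly n x / fact n)
      = Abs_fps (\<lambda>k. bernoulli k / fact k) * fps_exp x"
  proof (rule fps_ext)
    fix n
    have "real (n choose k) * bernoulli k * x ^ (n - k) / fact n
        = bernoulli k / fact k * (x ^ (n - k) / fact (n - k))" if "k \<le> n" for k
      using that by (simp add: binomial_fact)
    then show "fps_nth (Abs_fps (\<lambda>n. bernpoly n x / fact n)) n
        = fps_nth (Abs_fps (\<lambda>k. bernoulli k / fact k) * fps_exp x) n"
      by (simp add: fps_mult_nth bernpoly_def sum_divide_distrib atLeast0AtMost)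
  qed
  then have "Abs_fps (\<lambda>n. bernpoly n x / fact n) * (fps_exp 1 - 1)
      = (Abs_fps (\<lambda>k. bernoulli k / fact k) * (fps_exp 1 - 1)) * fps_exp x"
    by (simp only: ac_simps)
  then show ?thesis by (simp only: bernoulli_egf)
qed

lemma bernpoly_at_0: "bernpoly k 0 = bernoulli k"
proof -
  have "bernpoly k 0 = (\<Sum>j\<in>{k}. real (k choose j) * bernoulli j * 0 ^ (k - j))"
    unfolding bernpoly_def by (intro sum.mono_neutral_right) auto
  then show ?thesis by simp
qed

lemma bernoulli_0: "bernoulli 0 = 1"
  using arg_cong[OF bernoulli_egf, of "\<lambda>f. fps_nth f 1"] by (simp add: fps_mult_nth)

lemma bernoulli_1: "bernoulli 1 = - 1 / 2"
  using arg_cong[OF bernoulli_egf, of "\<lambda>f. fps_nth f 2"] bernoulli_0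
  by (simp add: fps_mult_nth numeral_2_eq_2)

end

(* Bernoulli polynomials form an Appell sequence, B_n' = n B_(n-1), which gives the matrix; it is
   unique because B_0, ..., B_N are linearly independent: differentiating a vanishing combination
   yields a vanishing combination of one fewer polynomial, and B_0 = 1. *)
theory Submission
  imports Defs
begin

lemma bernpoly_0: "bernpoly 0 x = 1"
  by (simp add: bernpoly_def bernoulli_0)

text \<open>Termwise differentiation, then the absorption identity
  \<open>(n - k) * (n choose k) = n * (n - 1 choose k)\<close>. At \<open>n = 0\<close> the
  truncated index \<open>n - 1\<close> is harmless, since the factor \<open>real n\<close>
  vanishes.\<close>

lemma has_real_derivative_bernpoly:
  "(bernpoly n has_real_derivative real n * bernpoly (n - 1) x) (at x within S)"
proof (cases n)
  case 0
  then have "bernpoly n = (\<lambda>_. 1)" by (simp add: fun_eq_iff bernpoly_0)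
  with 0 show ?thesis by simp
next
  case (Suc m)
  let ?d = "\<lambda>k. real (n choose k) * bernoulli k * (real (n - k) * x ^ (n - k - 1))"
  have "((\<lambda>t. \<Sum>k\<le>n. real (n choose k) * bernoulli k * t ^ (n - k))
      has_real_derivative (\<Sum>k\<le>n. ?d k)) (at x within S)"
    by (auto intro!: derivative_eq_intros sum.cong)
  moreover have "?d k = real n * (real (m choose k) * bernoulli k * x ^ (m - k))" if "k \<le> m" for k
  proof -
    have "real (n - k) * real (n choose k) = real n * real (m choose k)"
      using binomial_absorb_comp[of n k] Suc by (metis diff_Suc_1 of_nat_mult)
    moreover have "n - k - 1 = m - k" using Suc by simp
    ultimately show ?thesis by (simp add: mult_ac)
  qed
  then have "(\<Sum>k\<le>m. ?d k) = real n * bernpoly m x"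
    unfolding bernpoly_def sum_distrib_left by (intro sum.cong) auto
  \<comment> \<open>The top summand \<open>k = n\<close> is the derivative of a constant: its factor
    \<open>real (n - k)\<close> is 0.\<close>
  moreover have "(\<Sum>k\<le>n. ?d k) = (\<Sum>k\<le>m. ?d k)"
    by (simp add: Suc)
  ultimately show ?thesis
    by (simp add: Suc bernpoly_def[abs_def])
qed

text \<open>An open interval lets the vanishing relation be differentiated at each of its points
  with the ordinary two-sided derivative.\<close>

lemma bernpoly_linear_independent:
  assumes "a < b" and "\<And>x. x \<in> {a<..<b} \<Longrightarrow> (\<Sum>j\<le>n. c j * bernpoly j x) = 0" and "j \<le> n"
  shows "c j = 0"
  using assms(2,3)
proof (induction n arbitrary: c j)
  case 0
  with \<open>a < b\<close> dense[of a b] show ?case by (auto simp: bernpoly_0)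
next
  case (Suc n)
  \<comment> \<open>The differentiated relation, reindexed: its coefficients are
    \<open>c (Suc i)\<close> scaled by the nonzero \<open>Suc i\<close>, so the induction hypothesis
    kills every \<open>c\<close> except \<open>c 0\<close>.\<close>
  have "(\<Sum>i\<le>n. (c (Suc i) * real (Suc i)) * bernpoly i x) = 0" if x: "x \<in> {a<..<b}" for x
  proof -
    let ?D = "\<Sum>i\<le>Suc n. c i * (real i * bernpoly (i - 1) x)"
    have "((\<lambda>x. \<Sum>i\<le>Suc n. c i * bernpoly i x) has_real_derivative ?D) (at x)"
      by (intro DERIV_sum DERIV_cmult has_real_derivative_bernpoly)
    then have "((\<lambda>x. 0) has_real_derivative ?D) (at x)"
      by (rule has_field_derivative_transform_within_open[OF _ _ x]) (use Suc.prems in auto)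
    then have "?D = 0" by (rule DERIV_unique) simp
    \<comment> \<open>The summand of \<open>?D\<close> at \<open>i = 0\<close> carries the factor
      \<open>real 0\<close>, so splitting it off leaves just the shifted sum.\<close>
    then show ?thesis
      by (subst (asm) sum.atMost_Suc_shift) (simp add: mult.assoc)
  qed
  then have *: "c (Suc i) = 0" if "i \<le> n" for i
    using Suc.IH[of "\<lambda>i. c (Suc i) * real (Suc i)" i] that by simp
  \<comment> \<open>Only \<open>c 0\<close> times the constant 1 is left of the relation, so one
    point of the interval decides.\<close>
  obtain x where "x \<in> {a<..<b}" using dense[OF \<open>a < b\<close>] by auto
  then have "(\<Sum>i\<le>Suc n. c i * bernpoly i x) = 0" by (rule Suc.prems)
  then have "c 0 = 0"
    by (subst (asm) sum.atMost_Suc_shift) (simp add: * bernpoly_0)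
  with * Suc.prems(2) show ?case by (cases j) auto
qed

lemma mult_mat_bernvec_nth:
  assumes "D \<in> carrier_mat (N + 1) (N + 1)" and "i \<le> N"
  shows "(D *\<^sub>v bernvec N x) $ i = (\<Sum>j\<le>N. D $$ (i, j) * bernpoly j x)"
  using assms
  by (auto simp: bernvec_def scalar_prod_def atLeast0LessThan lessThan_Suc_atMost intro!: sum.cong)

text \<open>Unfolds the vector condition into one scalar derivative condition per row, the form in
  which both existence and uniqueness are argued.\<close>

lemma operational_matrix_bernvec_iff:
  "operational_matrix_of_derivatives (N + 1) (bernvec N) S D \<longleftrightarrow>
    D \<in> carrier_mat (N + 1) (N + 1) \<and>
    (\<forall>x\<in>S. \<forall>i\<le>N. (bernpoly i has_real_derivative (\<Sum>j\<le>N. D $$ (i, j) * bernpoly j x))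
      (at x within S))"
proof (cases "D \<in> carrier_mat (N + 1) (N + 1)")
  case True
  have "has_entrywise_derivative (bernvec N) (D *\<^sub>v bernvec N x) x S \<longleftrightarrow>
      (\<forall>i\<le>N. (bernpoly i has_real_derivative (\<Sum>j\<le>N. D $$ (i, j) * bernpoly j x))
        (at x within S))" for x
  proof -
    have "dim_vec (bernvec N t) = N + 1" for t
      by (simp add: bernvec_def)
    moreover have "dim_vec (D *\<^sub>v bernvec N x) = N + 1"
      using True by simp
    moreover have "(\<lambda>t. bernvec N t $ i) = bernpoly i" if "i < N + 1" for i
      using that by (simp add: bernvec_def)
    moreover have "i < N + 1 \<longleftrightarrow> i \<le> N" for i
      by linarith
    ultimately show ?thesis
      using mult_mat_bernvec_nth[OF True]
      unfolding has_entrywise_derivative_def by presburger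
  qed
  moreover have "bernvec N x \<in> carrier_vec (N + 1)" for x
    by (simp add: bernvec_def)
  ultimately show ?thesis
    using True unfolding operational_matrix_of_derivatives_def by blast
qed (simp add: operational_matrix_of_derivatives_def)

theorem theorem1:
  fixes N :: nat
  shows "(\<exists>!D. operational_matrix_of_derivatives (N + 1) (bernvec N) {0..1} D) \<and>
    (\<forall>D. operational_matrix_of_derivatives (N + 1) (bernvec N) {0..1} D \<longrightarrow>
      (\<forall>i\<in>{0..N}. \<forall>j\<in>{0..N}. D $$ (i, j) = (if i = j + 1 then real i else 0)))"
proof -
  define e where "e i j = (if i = j + 1 then real i else 0)" for i j :: nat
  define E where "E = mat (N + 1) (N + 1) (\<lambda>(i, j). e i j)"
  let ?op = "operational_matrix_of_derivatives (N + 1) (bernvec N) {0..1}"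
  \<comment> \<open>For \<open>i > 0\<close> the only nonzero entry of row \<open>i\<close> lies in
    column \<open>i - 1\<close>, which is in range because \<open>i \<le> N\<close>; row 0 is
    zero.\<close>
  have sum_e: "(\<Sum>j\<le>N. e i j * bernpoly j x) = real i * bernpoly (i - 1) x" if "i \<le> N" for i x
  proof (cases i)
    case (Suc m)
    then have "(\<Sum>j\<le>N. e i j * bernpoly j x)
        = (\<Sum>j\<le>N. if m = j then real i * bernpoly m x else 0)"
      by (intro sum.cong) (auto simp: e_def)
    with Suc that show ?thesis by simp
  qed (simp add: e_def)
  have "(\<Sum>j\<le>N. E $$ (i, j) * bernpoly j x) = real i * bernpoly (i - 1) x" if "i \<le> N" for i x
    by (subst sum_e[OF that, symmetric]) (use that in \<open>simp add: E_def\<close>)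
  then have "?op E"
    unfolding operational_matrix_bernvec_iff
    using has_real_derivative_bernpoly by (simp add: E_def)
  moreover have entries: "D $$ (i, j) = e i j" if D: "?op D" and ij: "i \<le> N" "j \<le> N" for D i j
  proof -
    \<comment> \<open>At interior points the derivative within \<open>{0..1}\<close> is the
      two-sided one, hence unique, so row \<open>i\<close> of \<open>D\<close> and row
      \<open>i\<close> of \<open>e\<close> give the same combination.\<close>
    have "(\<Sum>j\<le>N. (D $$ (i, j) - e i j) * bernpoly j x) = 0" if x: "x \<in> {0<..<1}" for x
    proof -
      have "(bernpoly i has_real_derivative (\<Sum>j\<le>N. D $$ (i, j) * bernpoly j x))
          (at x within {0..1})"
        using D[unfolded operational_matrix_bernvec_iff] ij x by simp
      then have "(\<Sum>j\<le>N. D $$ (i, j) * bernpoly j x) = real i * bernpoly (i - 1) x"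
        using x has_real_derivative_bernpoly[of i x UNIV]
        by (simp add: at_within_Icc_at DERIV_unique)
      with ij show ?thesis
        by (simp add: left_diff_distrib sum_subtractf sum_e)
    qed
    with ij(2) show ?thesis
      using bernpoly_linear_independent[of 0 1 "\<lambda>j. D $$ (i, j) - e i j" N j] by simp
  qed
  \<comment> \<open>Indexing outside the dimensions is not controlled by \<open>entries\<close>; the
    carrier condition in \<open>?op\<close> supplies equal dimensions.\<close>
  moreover have "D = E" if D: "?op D" for D
  proof (rule eq_matI)
    show "D $$ (i, j) = E $$ (i, j)" if "i < dim_row E" "j < dim_col E" for i j
      using that entries[OF D, of i j] by (simp add: E_def)
  qed (use D[unfolded operational_matrix_bernvec_iff] in \<open>auto simp: E_def\<close>)
  ultimately show ?thesis
    unfolding e_def by (metis atLeastAtMost_iff)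
qed

end
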